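(* The value-bisection algorithm can be used to approximate the minimum value of a function $f$ which is continuous on the interval $[a,b]$.
   Context: The value-bisection algorithm is a procedure for approximating the maximum value of a continuous function $g$ on a closed interval $[a,b]$. It starts from a number $m_0$ with $\min\{g(a),g(b)\}\le m_0\le\max_{[a,b]}g$ and an upper bound $u_0$ for $g$ on $[a,b]$, and proceeds recursively. Given $m_n,u_n$, put $c_n=\frac{m_n+u_n}{2}$. If the equation $g(x)=c_n$ has a solution $x\in[a,b]$, set $m_{n+1}=c_n$ and $u_{n+1}=u_n$; if it has no solution in $[a,b]$, set $m_{n+1}=m_n$ and $u_{n+1}=c_n$. The midpoint $c_n$ is the approximation of the maximum value of $g$ at the $n$-th step. *)

theory Defs
  imports Complex_Main
begin

definition is_max_value :: "(real \<Rightarrow> real) \<Rightarrow> real set \<Rightarrow> real \<Rightarrow> bool" where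
  "is_max_value g S M \<longleftrightarrow> M \<in> g ` S \<and> (\<forall>x\<in>S. g x \<le> M)"

definition is_min_value :: "(real \<Rightarrow> real) \<Rightarrow> real set \<Rightarrow> real \<Rightarrow> bool" where
  "is_min_value f S \<mu> \<longleftrightarrow> \<mu> \<in> f ` S \<and> (\<forall>x\<in>S. \<mu> \<le> f x)"

definition vb_start :: "(real \<Rightarrow> real) \<Rightarrow> real \<Rightarrow> real \<Rightarrow> real \<Rightarrow> real \<Rightarrow> bool" where
  "vb_start g a b m0 u0 \<longleftrightarrow>
     min (g a) (g b) \<le> m0 \<and>
     (\<exists>M. is_max_value g {a..b} M \<and> m0 \<le> M) \<and>
     (\<forall>x\<in>{a..b}. g x \<le> u0)"

text \<open>The state after \<open>n\<close> steps is the pair \<open>(m\<^sub>n, u\<^sub>n)\<close>. The case distinction on solvability of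
  \<open>g x = c\<^sub>n\<close> is classical and carries no computational content.\<close>

primrec vb_state ::
  "(real \<Rightarrow> real) \<Rightarrow> real \<Rightarrow> real \<Rightarrow> real \<Rightarrow> real \<Rightarrow> nat \<Rightarrow> real \<times> real" where
  "vb_state g a b m0 u0 0 = (m0, u0)"
| "vb_state g a b m0 u0 (Suc n) =
     (let (m, u) = vb_state g a b m0 u0 n; c = (m + u) / 2
      in if \<exists>x\<in>{a..b}. g x = c then (c, u) else (m, c))"

definition vb_approx ::
  "(real \<Rightarrow> real) \<Rightarrow> real \<Rightarrow> real \<Rightarrow> real \<Rightarrow> real \<Rightarrow> nat \<Rightarrow> real" where
  "vb_approx g a b m0 u0 n =
     (let (m, u) = vb_state g a b m0 u0 n in (m + u) / 2)"

end

(* Let g = -f. By the intermediate value theorem g attains every value c between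
   min (g a) (g b) and its maximum M, so an unsolvable equation g x = c with
   c >= min (g a) (g b) forces c > M. Hence every step keeps M between m and u while halving
   u - m; the midpoints converge to M, and their negatives to -M, the minimum of f. *)
theory Submission
  imports Defs
begin

text \<open>The image of an interval under a continuous map is connected. It contains
  \<open>M\<close> and the smaller endpoint value, hence everything between them.\<close>

lemma value_attained_below_max:
  fixes g :: "real \<Rightarrow> real"
  assumes "a \<le> b" "continuous_on {a..b} g" "is_max_value g {a..b} M"
    and "min (g a) (g b) \<le> c" "c \<le> M"
  shows "\<exists>x\<in>{a..b}. g x = c"
proof -
  have "connected (g ` {a..b})"
    using assms(2) by (intro connected_continuous_image connected_Icc)
  moreover have "min (g a) (g b) \<in> g ` {a..b}"
    using assms(1) by (auto simp: min_def)
  moreover have "M \<in> g ` {a..b}"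
    using assms(3) by (simp add: is_max_value_def)
  ultimately have "c \<in> g ` {a..b}"
    using assms(4,5) by (rule connectedD_interval)
  then show ?thesis by auto
qed

text \<open>The invariant of the recursion. The bound \<open>min (g a) (g b) \<le> m\<close> is
  carried along because it keeps every midpoint in the range where an unsolvable equation can only
  mean that the midpoint exceeds \<open>M\<close>.\<close>

lemma vb_state_bounds:
  assumes "a \<le> b" "continuous_on {a..b} g" "is_max_value g {a..b} M"
    and "min (g a) (g b) \<le> m0" "m0 \<le> M" "M \<le> u0"
    and "vb_state g a b m0 u0 n = (m, u)"
  shows "min (g a) (g b) \<le> m \<and> m \<le> M \<and> M \<le> u \<and> u - m = (u0 - m0) / 2 ^ n"
  using assms(7)
proof (induction n arbitrary: m u)
  case 0
  then show ?case using assms(4-6) by auto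
next
  case (Suc n)
  obtain m' u' where st: "vb_state g a b m0 u0 n = (m', u')" by fastforce
  define c where "c = (m' + u') / 2"
  have IH: "min (g a) (g b) \<le> m'" "m' \<le> M" "M \<le> u'" "u' - m' = (u0 - m0) / 2 ^ n"
    using Suc.IH[OF st] by auto
  \<comment> \<open>One equation for each outcome: the new bracket is either the upper half, from
    \<open>c\<close> to \<open>u'\<close>, or the lower half, from \<open>m'\<close> to
    \<open>c\<close>.\<close>
  have width: "c - m' = (u0 - m0) / 2 ^ Suc n" "u' - c = (u0 - m0) / 2 ^ Suc n"
    using IH(4) by (simp_all add: c_def field_simps)
  have lower: "min (g a) (g b) \<le> c"
    using IH(1-3) by (simp add: c_def)
  show ?case
  proof (cases "\<exists>x\<in>{a..b}. g x = c")
    case True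
    then have "m = c" "u = u'"
      using Suc.prems st by (auto simp: Let_def c_def)
    moreover have "c \<le> M"
      using True assms(3) by (auto simp: is_max_value_def)
    ultimately show ?thesis using IH lower width by simp
  next
    case False
    then have "m = m'" "u = c"
      using Suc.prems st by (auto simp: Let_def c_def)
    \<comment> \<open>By contraposition: if \<open>c\<close> were below \<open>M\<close>, it would
      be attained.\<close>
    moreover have "M \<le> c"
      using False value_attained_below_max[OF assms(1-3) lower] by force
    ultimately show ?thesis using IH width by simp
  qed
qed

lemma vb_approx_tendsto_max:
  assumes "a \<le> b" "continuous_on {a..b} g" "is_max_value g {a..b} M"
    and "vb_start g a b m0 u0"
  shows "vb_approx g a b m0 u0 \<longlonglongrightarrow> M"
proof -
  \<comment> \<open>\<open>M \<le> u0\<close> holds because \<open>M\<close> is itself a value of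
    \<open>g\<close> on the interval.\<close>
  have start: "min (g a) (g b) \<le> m0" "m0 \<le> M" "M \<le> u0"
    using assms(3,4) by (force simp: vb_start_def is_max_value_def)+
  \<comment> \<open>\<open>M\<close> and the midpoint both lie between \<open>m\<close> and
    \<open>u\<close>, so the error is at most the width \<open>u - m\<close>. This is twice the
    optimal bound, but still geometric.\<close>
  have bound: "norm (vb_approx g a b m0 u0 n - M) \<le> (u0 - m0) * (1 / 2) ^ n" for n
  proof -
    obtain m u where st: "vb_state g a b m0 u0 n = (m, u)" by fastforce
    from vb_state_bounds[OF assms(1-3) start st]
    have "m \<le> M" "M \<le> u" "u - m = (u0 - m0) * (1 / 2) ^ n"
      by (simp_all add: power_one_over)
    moreover from this(1,2) have "\<bar>(m + u) / 2 - M\<bar> \<le> u - m"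
      by (simp add: abs_le_iff field_simps)
    ultimately show ?thesis
      by (simp add: vb_approx_def st)
  qed
  have "(\<lambda>n. (u0 - m0) * (1 / 2) ^ n) \<longlonglongrightarrow> 0"
    by (intro tendsto_mult_right_zero LIMSEQ_power_zero) simp
  then have "(\<lambda>n. norm (vb_approx g a b m0 u0 n - M)) \<longlonglongrightarrow> 0"
    \<comment> \<open>Squeeze between the constant 0 and the geometric bound;
      \<open>rotated 2\<close> moves the limit of the upper bound to the front, to meet the chained
      fact.\<close>
    by (rule tendsto_sandwich[OF _ _ tendsto_const, rotated 2]) (simp_all add: bound[simplified])
  then show ?thesis by (simp only: tendsto_norm_zero_iff LIM_zero_iff)
qed

theorem corollary3p4:
  fixes f :: "real \<Rightarrow> real" and a b :: real
  assumes "a \<le> b" and "continuous_on {a..b} f"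
  shows "\<exists>\<mu>. is_min_value f {a..b} \<mu> \<and>
           (\<exists>m0 u0. vb_start (\<lambda>x. - f x) a b m0 u0) \<and>
           (\<forall>m0 u0. vb_start (\<lambda>x. - f x) a b m0 u0 \<longrightarrow>
              (\<lambda>n. - vb_approx (\<lambda>x. - f x) a b m0 u0 n) \<longlonglongrightarrow> \<mu>)"
proof -
  let ?g = "\<lambda>x. - f x"
  have cont: "continuous_on {a..b} ?g"
    using assms(2) by (rule continuous_on_minus)
  obtain x where x: "x \<in> {a..b}" "\<forall>y\<in>{a..b}. f x \<le> f y"
    using continuous_attains_inf[OF compact_Icc _ assms(2)] assms(1) by auto
  have min: "is_min_value f {a..b} (f x)" and max: "is_max_value ?g {a..b} (- f x)"
    using x by (auto simp: is_min_value_def is_max_value_def)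
  have "min (?g a) (?g b) \<le> - f x"
    using x assms(1) by (simp add: min_le_iff_disj)
  \<comment> \<open>The maximum of \<open>?g\<close> serves as both \<open>m0\<close> and
    \<open>u0\<close>. This degenerate start shows that the convergence claim is not
    vacuous.\<close>
  then have "vb_start ?g a b (- f x) (- f x)"
    using max x(2) unfolding vb_start_def by (intro conjI exI[of _ "- f x"]) simp_all
  moreover have "(\<lambda>n. - vb_approx ?g a b m0 u0 n) \<longlonglongrightarrow> f x"
    if "vb_start ?g a b m0 u0" for m0 u0
    using tendsto_minus[OF vb_approx_tendsto_max[OF assms(1) cont max that]] by simp
  ultimately show ?thesis using min by blast
qed

end
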